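(* Let $A$ and $B$ be nonempty closed convex subsets of a real Hilbert space $\mathcal L$, and let $0<\beta<1$. Let $V(T_*,\beta)=\beta\,T_*+(1-\beta)P_B$ with $T_*=\tfrac12(R_AR_B+I)$. Then $$\operatorname{Fix} V(T_*,\beta)=F-\frac{\beta}{1-\beta}\,g,$$ where $g$ is the gap vector between $A$ and $B$ and $F\subset B$ is the set of points in $B$ nearest to $A$. Moreover, for every $u\in\operatorname{Fix}V(T_*,\beta)$ the following hold: (i) $u=P_Bu-\dfrac{\beta}{1-\beta}\,g$; (ii) $P_Bu-P_AR_Bu=g$; (iii) $P_Bu\in F$ and $P_AP_Bu\in E$, where $E\subset A$ is the set of points in $A$ nearest to $B$.
   Context: For a nonempty closed convex set $C\subset\mathcal L$, $P_C$ denotes the metric projection onto $C$ and $R_C=2P_C-I$ the corresponding reflector, where $I$ is the identity; products of operators denote composition. $\operatorname{Fix}T=\{u\in\mathcal L: Tu=u\}$. The gap vector between $A$ and $B$ is $g=P_{\mathrm{cl}(B-A)}(0)$, where $B-A=\{b-a: b\in B,\ a\in A\}$ and $\mathrm{cl}$ denotes closure; its norm $\|g\|$ is the distance $\inf\{\|a-b\|: a\in A,\ b\in B\}$. $E=\{a\in A:\inf_{b\in B}\|a-b\|=\|g\|\}$ is the set of points in $A$ nearest to $B$, and $F=\{b\in B:\inf_{a\in A}\|a-b\|=\|g\|\}$ is the set of points in $B$ nearest to $A$. The sets $E$ and $F$ may be empty. The notation $F-w$ means $\{f-w: f\in F\}$ (empty if $F$ is empty). *)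

theory Defs
  imports "HOL-Analysis.Analysis"
begin

text \<open>
  The library's metric projection \<open>closest_point\<close> is restricted to \<open>heine_borel\<close> (that is,
  finite-dimensional) spaces, so the projection is defined here for arbitrary metric spaces.
  The nearest point exists and is unique when \<open>C\<close> is a nonempty closed convex subset of a
  Hilbert space; otherwise the value may be unspecified.
\<close>

definition proj :: "'a::metric_space set \<Rightarrow> 'a \<Rightarrow> 'a" where
  "proj C x = (THE p. p \<in> C \<and> (\<forall>y\<in>C. dist x p \<le> dist x y))"

definition refl_proj :: "'a::real_inner set \<Rightarrow> 'a \<Rightarrow> 'a" where
  "refl_proj C x = 2 *\<^sub>R proj C x - x"

definition Fix :: "('a \<Rightarrow> 'a) \<Rightarrow> 'a set" where
  "Fix T = {u. T u = u}"

definition T_star :: "'a::real_inner set \<Rightarrow> 'a set \<Rightarrow> 'a \<Rightarrow> 'a" where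
  "T_star A B u = (1/2) *\<^sub>R ((refl_proj A \<circ> refl_proj B) u + u)"

definition V :: "'a::real_inner set \<Rightarrow> ('a \<Rightarrow> 'a) \<Rightarrow> real \<Rightarrow> 'a \<Rightarrow> 'a" where
  "V B T \<beta> u = \<beta> *\<^sub>R T u + (1 - \<beta>) *\<^sub>R proj B u"

text \<open>The gap vector points from \<open>A\<close> to \<open>B\<close>.\<close>

definition gap :: "'a::real_inner set \<Rightarrow> 'a set \<Rightarrow> 'a" where
  "gap A B = proj (closure {b - a | a b. a \<in> A \<and> b \<in> B}) 0"

definition nearest_in_fst :: "'a::real_inner set \<Rightarrow> 'a set \<Rightarrow> 'a set" where
  "nearest_in_fst A B = {a \<in> A. (INF b\<in>B. norm (a - b)) = norm (gap A B)}"

definition nearest_in_snd :: "'a::real_inner set \<Rightarrow> 'a set \<Rightarrow> 'a set" where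
  "nearest_in_snd A B = {b \<in> B. (INF a\<in>A. norm (a - b)) = norm (gap A B)}"

end

theory Submission
  imports Defs
begin

text \<open>
  The proof rests on the obtuse-angle characterization of the projection: \<open>p = proj C x\<close> iff
  \<open>p \<in> C\<close> and \<open>x - p\<close> makes a nonpositive inner product with \<open>y - p\<close> for all \<open>y \<in> C\<close>.  This
  condition depends only on the direction of \<open>x - p\<close>, so a point may be moved along the ray
  from its projection without changing the projection.

  Write \<open>b = proj B u\<close>, \<open>a = proj A (refl_proj B u)\<close>, \<open>d = b - a\<close> and \<open>\<gamma> = \<beta> / (1 - \<beta>)\<close>.
  Since \<open>T_star A B u = u - d\<close>, the equation \<open>V B (T_star A B) \<beta> u = u\<close> says exactly that
  \<open>u = b - \<gamma> *\<^sub>R d\<close>, and then \<open>refl_proj B u = a + (1 + \<gamma>) *\<^sub>R d\<close>.  So \<open>u\<close> lies on the ray from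
  \<open>b\<close> in direction \<open>- d\<close> and \<open>refl_proj B u\<close> on the ray from \<open>a\<close> in direction \<open>d\<close>.  The two
  projection conditions thus say that \<open>inner d\<close> is maximal over \<open>A\<close> at \<open>a\<close> and minimal over
  \<open>B\<close> at \<open>b\<close>; adding them gives the obtuse-angle condition for \<open>d\<close> as the projection of \<open>0\<close>
  onto the closure of the set of differences, that is, \<open>d = gap A B\<close> (lemma \<open>gap_eq_iff_proj\<close>).
  The pair \<open>a\<close>, \<open>b\<close> therefore realizes the distance between \<open>A\<close> and \<open>B\<close>.

  Conversely, a point \<open>b\<close> of \<open>B\<close> nearest to \<open>A\<close> and
  \<open>a = proj A b\<close> realize the distance, so \<open>b - a = gap A B\<close> by uniqueness of the projection,
  and the same equivalences read backwards make \<open>b - \<gamma> *\<^sub>R gap A B\<close> a fixed point.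
\<close>

section \<open>Projection onto closed convex sets in Hilbert space\<close>

text \<open>
  A minimizing sequence is Cauchy by the parallelogram law: the midpoint of two points of \<open>C\<close>
  lies in \<open>C\<close>, so it cannot be closer to \<open>x\<close> than \<open>infdist x C\<close>, which forces two
  almost-minimizers to be close to each other.
\<close>

lemma nearest_point_exists:
  fixes C :: "'a::{real_inner, complete_space} set"
  assumes "C \<noteq> {}" "closed C" "convex C"
  shows "\<exists>p\<in>C. \<forall>y\<in>C. dist x p \<le> dist x y"
proof -
  define \<delta> where "\<delta> = infdist x C"
  have \<delta>0: "0 \<le> \<delta>"
    by (simp add: \<delta>_def infdist_nonneg)
  have lower: "\<delta>\<^sup>2 \<le> (dist x y)\<^sup>2" if "y \<in> C" for y
    using that \<delta>0 by (simp add: \<delta>_def infdist_le power_mono)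
  (* Bounding the squared distance lets the errors enter the parallelogram law additively. *)
  have "\<exists>y\<in>C. (dist x y)\<^sup>2 < \<delta>\<^sup>2 + 1 / real (Suc n)" for n
  proof -
    have "\<delta> < sqrt (\<delta>\<^sup>2 + 1 / real (Suc n))"
      by (rule real_less_rsqrt) simp
    then obtain y where y: "y \<in> C" "dist x y < sqrt (\<delta>\<^sup>2 + 1 / real (Suc n))"
      using cINF_less_iff[of C "dist x"] assms(1)
      by (auto simp: \<delta>_def infdist_notempty)
    then have "(dist x y)\<^sup>2 < (sqrt (\<delta>\<^sup>2 + 1 / real (Suc n)))\<^sup>2"
      by (intro power_strict_mono) auto
    then show ?thesis
      using y(1) by auto
  qed
  then obtain Y where Y: "\<And>n. Y n \<in> C"
      "\<And>n. (dist x (Y n))\<^sup>2 < \<delta>\<^sup>2 + 1 / real (Suc n)"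
    by metis
  have parallelogram: "(dist (Y m) (Y n))\<^sup>2 < 2 / real (Suc m) + 2 / real (Suc n)" for m n
  proof -
    have "(1/2) *\<^sub>R Y m + (1/2) *\<^sub>R Y n \<in> C"
      using convexD[OF assms(3) Y(1)[of m] Y(1)[of n], of "1/2" "1/2"] by simp
    from lower[OF this]
    have "\<delta>\<^sup>2 \<le> (dist x ((1/2) *\<^sub>R Y m + (1/2) *\<^sub>R Y n))\<^sup>2" .
    moreover have "(dist (Y m) (Y n))\<^sup>2 = 2 * (dist x (Y m))\<^sup>2 + 2 * (dist x (Y n))\<^sup>2
        - 4 * (dist x ((1/2) *\<^sub>R Y m + (1/2) *\<^sub>R Y n))\<^sup>2"
      by (simp add: dist_norm power2_norm_eq_inner inner_diff_left inner_diff_right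
          inner_add_left inner_add_right inner_commute algebra_simps)
    ultimately show ?thesis
      using Y(2)[of m] Y(2)[of n] by (simp add: algebra_simps)
  qed
  have "Cauchy Y"
  proof (rule metric_CauchyI)
    fix e :: real
    assume "0 < e"
    then obtain N where N: "inverse (real (Suc N)) < e\<^sup>2 / 4"
      using reals_Archimedean[of "e\<^sup>2 / 4"] by auto
    have "dist (Y m) (Y n) < e" if "m \<ge> N" "n \<ge> N" for m n
    proof -
      have "1 / real (Suc m) \<le> 1 / real (Suc N)" "1 / real (Suc n) \<le> 1 / real (Suc N)"
        using that by (auto simp: field_simps)
      then have "(dist (Y m) (Y n))\<^sup>2 < e\<^sup>2"
        using parallelogram[of m n] N by (simp add: inverse_eq_divide)
      then show ?thesis
        using \<open>0 < e\<close> by (simp add: power_less_imp_less_base)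
    qed
    then show "\<exists>N. \<forall>m\<ge>N. \<forall>n\<ge>N. dist (Y m) (Y n) < e"
      by blast
  qed
  then obtain p where p: "Y \<longlonglongrightarrow> p"
    using Cauchy_convergent_iff convergent_def by blast
  have "p \<in> C"
    using closed_sequentially[OF assms(2)] Y(1) p by blast
  moreover have "dist x p \<le> dist x y" if "y \<in> C" for y
  proof -
    have "(dist x p)\<^sup>2 \<le> \<delta>\<^sup>2 + 0"
    proof (rule LIMSEQ_le)
      show "(\<lambda>n. (dist x (Y n))\<^sup>2) \<longlonglongrightarrow> (dist x p)\<^sup>2"
        by (intro tendsto_intros p)
      show "(\<lambda>n. \<delta>\<^sup>2 + 1 / real (Suc n)) \<longlonglongrightarrow> \<delta>\<^sup>2 + 0"
        using LIMSEQ_inverse_real_of_nat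
        by (intro tendsto_intros) (simp add: inverse_eq_divide)
      show "\<exists>N. \<forall>n\<ge>N. (dist x (Y n))\<^sup>2 \<le> \<delta>\<^sup>2 + 1 / real (Suc n)"
        using Y(2) less_imp_le by blast
    qed
    then have "(dist x p)\<^sup>2 \<le> (dist x y)\<^sup>2"
      using lower[OF that] by linarith
    then show ?thesis
      by (rule power2_le_imp_le) simp
  qed
  ultimately show ?thesis
    by blast
qed

lemma proj_nearest:
  fixes C :: "'a::{real_inner, complete_space} set"
  assumes "C \<noteq> {}" "closed C" "convex C"
  shows "proj C x \<in> C" and "\<And>y. y \<in> C \<Longrightarrow> dist x (proj C x) \<le> dist x y"
proof -
  have "\<exists>!p. p \<in> C \<and> (\<forall>y\<in>C. dist x p \<le> dist x y)"
    using nearest_point_exists[OF assms, of x] any_closest_point_unique[OF assms(3,2)]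
    by blast
  then have "proj C x \<in> C \<and> (\<forall>y\<in>C. dist x (proj C x) \<le> dist x y)"
    unfolding proj_def by (rule theI')
  then show "proj C x \<in> C" "\<And>y. y \<in> C \<Longrightarrow> dist x (proj C x) \<le> dist x y"
    by auto
qed

lemma proj_unique:
  fixes C :: "'a::{real_inner, complete_space} set"
  assumes "closed C" "convex C" and "p \<in> C" and "\<And>y. y \<in> C \<Longrightarrow> dist x p \<le> dist x y"
  shows "proj C x = p"
proof (rule any_closest_point_unique[OF assms(2,1) _ assms(3)])
  have "C \<noteq> {}"
    using assms(3) by blast
  then show "proj C x \<in> C" "\<forall>y\<in>C. dist x (proj C x) \<le> dist x y"
    using proj_nearest[OF _ assms(1,2)] by simp_all
  show "\<forall>y\<in>C. dist x p \<le> dist x y"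
    using assms(4) by blast
qed

lemma proj_eq_iff_inner:
  fixes C :: "'a::{real_inner, complete_space} set"
  assumes "C \<noteq> {}" "closed C" "convex C"
  shows "proj C x = p \<longleftrightarrow> p \<in> C \<and> (\<forall>y\<in>C. inner (x - p) (y - p) \<le> 0)"
proof
  assume p: "proj C x = p"
  have "p \<in> C" "\<forall>y\<in>C. dist x p \<le> dist x y"
    using proj_nearest[OF assms, where x = x] by (simp_all add: p)
  then show "p \<in> C \<and> (\<forall>y\<in>C. inner (x - p) (y - p) \<le> 0)"
    using any_closest_point_dot[OF assms(3,2)] by simp
next
  assume p: "p \<in> C \<and> (\<forall>y\<in>C. inner (x - p) (y - p) \<le> 0)"
  have "dist x p \<le> dist x y" if "y \<in> C" for y
  proof (rule power2_le_imp_le)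
    have "(dist x y)\<^sup>2 = (dist x p)\<^sup>2 + (dist y p)\<^sup>2 - 2 * inner (x - p) (y - p)"
      by (simp add: dist_norm power2_norm_eq_inner inner_diff_left inner_diff_right inner_commute)
    then show "(dist x p)\<^sup>2 \<le> (dist x y)\<^sup>2"
      using p that by (smt (verit) zero_le_power2)
  qed simp
  then show "proj C x = p"
    using p by (intro proj_unique[OF assms(2,3)]) auto
qed

lemma proj_ray_eq_iff:
  fixes C :: "'a::{real_inner, complete_space} set"
  assumes "C \<noteq> {}" "closed C" "convex C" and "p \<in> C" and "0 < t"
  shows "proj C (p + t *\<^sub>R v) = p \<longleftrightarrow> (\<forall>y\<in>C. inner v (y - p) \<le> 0)"
  using assms by (simp add: proj_eq_iff_inner mult_le_0_iff)

section \<open>The gap vector and the nearest points\<close>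

lemma closed_convex_differences:
  fixes A B :: "'a::real_inner set"
  assumes "A \<noteq> {}" "convex A" "B \<noteq> {}" "convex B"
  defines "D \<equiv> closure {b - a | a b. a \<in> A \<and> b \<in> B}"
  shows "D \<noteq> {}" "closed D" "convex D"
proof -
  have "{b - a | a b. a \<in> A \<and> b \<in> B} = (\<Union>b\<in>B. \<Union>a\<in>A. {b - a})"
    by blast
  then have "convex {b - a | a b. a \<in> A \<and> b \<in> B}"
    using convex_differences[OF assms(4,2)] by simp
  then show "convex D"
    unfolding D_def by (rule convex_closure)
  show "D \<noteq> {}" "closed D"
    using assms(1,3) by (auto simp: D_def)
qed

lemma norm_gap_le:
  fixes A B :: "'a::{real_inner, complete_space} set"
  assumes "convex A" "convex B" and "a \<in> A" "b \<in> B"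
  shows "norm (gap A B) \<le> norm (b - a)"
proof -
  have "b - a \<in> closure {b - a | a b. a \<in> A \<and> b \<in> B}"
    using assms(3,4) by (intro subsetD[OF closure_subset]) blast
  from proj_nearest(2)[OF closed_convex_differences this, of 0] show ?thesis
    using assms by (auto simp: gap_def)
qed

text \<open>
  For a pair \<open>a \<in> A\<close>, \<open>b \<in> B\<close>, the obtuse-angle condition for \<open>b - a\<close> as a projection onto
  differences splits into one condition on \<open>A\<close> and one on \<open>B\<close>: freezing one of the two points
  gives the conditions from the combined one, and adding them gives it back.
\<close>

lemma gap_eq_iff_inner:
  fixes A B :: "'a::{real_inner, complete_space} set"
  assumes "convex A" "convex B" and ab: "a \<in> A" "b \<in> B"
  shows "gap A B = b - a \<longleftrightarrow>
    (\<forall>x\<in>A. inner (b - a) (x - a) \<le> 0) \<and> (\<forall>y\<in>B. inner (- (b - a)) (y - b) \<le> 0)"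
    (is "_ \<longleftrightarrow> ?sep")
proof -
  let ?D = "{b - a | a b. a \<in> A \<and> b \<in> B}"
  let ?H = "{z. inner (0 - (b - a)) (z - (b - a)) \<le> 0}"
  have ne: "A \<noteq> {}" "B \<noteq> {}"
    using ab by auto
  have D: "b - a \<in> ?D"
    using ab by blast
  have "closed ?H"
    by (intro closed_Collect_le continuous_intros)
  then have "closure ?D \<subseteq> ?H \<longleftrightarrow> ?D \<subseteq> ?H"
    by (metis (no_types, lifting) closure_minimal closure_subset subset_trans)
  moreover have "gap A B = b - a \<longleftrightarrow> closure ?D \<subseteq> ?H"
    unfolding gap_def
    using proj_eq_iff_inner[OF closed_convex_differences[OF ne(1) assms(1) ne(2) assms(2)],
        of 0 "b - a"] subsetD[OF closure_subset D]
    by auto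
  moreover have "?D \<subseteq> ?H \<longleftrightarrow> (\<forall>x\<in>A. \<forall>y\<in>B. inner (- (b - a)) ((y - x) - (b - a)) \<le> 0)"
    by auto
  moreover have "\<dots> \<longleftrightarrow> ?sep"
  proof
    assume L: "\<forall>x\<in>A. \<forall>y\<in>B. inner (- (b - a)) ((y - x) - (b - a)) \<le> 0"
    have "inner (b - a) (x - a) \<le> 0" if "x \<in> A" for x
      using L[rule_format, OF that ab(2)] by (simp add: inner_diff_right inner_diff_left)
    moreover have "inner (- (b - a)) (y - b) \<le> 0" if "y \<in> B" for y
      using L[rule_format, OF ab(1) that] by (simp add: inner_diff_right inner_diff_left)
    ultimately show ?sep
      by blast
  next
    assume R: ?sep
    have "inner (- (b - a)) ((y - x) - (b - a)) \<le> 0" if "x \<in> A" "y \<in> B" for x y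
    proof -
      have "inner (- (b - a)) ((y - x) - (b - a))
          = inner (b - a) (x - a) + inner (- (b - a)) (y - b)"
        by (simp add: inner_diff_right inner_diff_left)
      then show ?thesis
        using R that by (smt (verit))
    qed
    then show "\<forall>x\<in>A. \<forall>y\<in>B. inner (- (b - a)) ((y - x) - (b - a)) \<le> 0"
      by blast
  qed
  ultimately show ?thesis
    by simp
qed

text \<open>
  The step lengths \<open>s\<close> and \<open>t\<close> are arbitrary because only the directions matter; a fixed point
  supplies \<open>\<beta> / (1 - \<beta>)\<close> and \<open>1 + \<beta> / (1 - \<beta>)\<close>, while \<open>t = 1\<close> says \<open>proj A b = a\<close>.
\<close>

lemma gap_eq_iff_proj:
  fixes A B :: "'a::{real_inner, complete_space} set"
  assumes "closed A" "convex A" "closed B" "convex B" and "a \<in> A" "b \<in> B" and "0 < s" "0 < t"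
  shows "gap A B = b - a \<longleftrightarrow>
    proj A (a + t *\<^sub>R (b - a)) = a \<and> proj B (b - s *\<^sub>R (b - a)) = b"
proof -
  have "proj A (a + t *\<^sub>R (b - a)) = a \<longleftrightarrow> (\<forall>x\<in>A. inner (b - a) (x - a) \<le> 0)"
    using assms by (intro proj_ray_eq_iff) auto
  moreover have "proj B (b + s *\<^sub>R (- (b - a))) = b \<longleftrightarrow> (\<forall>y\<in>B. inner (- (b - a)) (y - b) \<le> 0)"
    using assms by (intro proj_ray_eq_iff) auto
  moreover have "b + s *\<^sub>R (- (b - a)) = b - s *\<^sub>R (b - a)"
    by (simp add: algebra_simps)
  ultimately show ?thesis
    using gap_eq_iff_inner[OF assms(2,4-6)] by simp
qed

lemma gap_realizers_nearest:
  fixes A B :: "'a::{real_inner, complete_space} set"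
  assumes "convex A" "convex B" and "a \<in> A" "b \<in> B" and "b - a = gap A B"
  shows "a \<in> nearest_in_fst A B" and "b \<in> nearest_in_snd A B"
proof -
  have *: "norm (a - b) = norm (gap A B)"
    using assms(5) by (metis norm_minus_commute)
  have "(INF y\<in>B. norm (a - y)) = norm (a - b)"
    using norm_gap_le[OF assms(1-3)] assms(4) *
    by (intro cInf_eq_minimum imageI) (auto simp: norm_minus_commute[of a])
  then show "a \<in> nearest_in_fst A B"
    using assms(3) * by (simp add: nearest_in_fst_def)
  have "(INF x\<in>A. norm (x - b)) = norm (a - b)"
    using norm_gap_le[OF assms(1,2) _ assms(4)] assms(3) *
    by (intro cInf_eq_minimum imageI) (auto simp: norm_minus_commute[of _ b])
  then show "b \<in> nearest_in_snd A B"
    using assms(4) * by (simp add: nearest_in_snd_def)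
qed

text \<open>
  The infimum defining \<open>nearest_in_snd\<close> is attained at \<open>proj A b\<close>, so \<open>b - proj A b\<close> has the
  norm of the gap vector; the element of least norm in a closed convex set being unique, it is
  the gap vector.
\<close>

lemma nearest_in_snd_diff_proj:
  fixes A B :: "'a::{real_inner, complete_space} set"
  assumes A: "A \<noteq> {}" "closed A" "convex A" and "convex B" and b: "b \<in> nearest_in_snd A B"
  shows "b - proj A b = gap A B"
proof -
  let ?D = "closure {b - a | a b. a \<in> A \<and> b \<in> B}"
  have bB: "b \<in> B" and inf: "(INF a\<in>A. norm (a - b)) = norm (gap A B)"
    using b by (auto simp: nearest_in_snd_def)
  have "(INF a\<in>A. norm (a - b)) = norm (proj A b - b)"
    using proj_nearest[OF A, where x = b]
    by (intro cInf_eq_minimum) (auto simp: dist_norm norm_minus_commute[of _ b])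
  then have norm_eq: "norm (b - proj A b) = norm (gap A B)"
    using inf by (simp add: norm_minus_commute)
  have D: "?D \<noteq> {}" "closed ?D" "convex ?D"
    using closed_convex_differences[OF A(1,3) _ assms(4)] bB by blast+
  have "b - proj A b \<in> ?D"
    using bB proj_nearest(1)[OF A, of b] by (intro subsetD[OF closure_subset]) blast
  then have "proj ?D 0 = b - proj A b"
    using proj_nearest(2)[OF D, of _ 0] norm_eq
    by (intro proj_unique[OF D(2,3)]) (auto simp: gap_def)
  then show ?thesis
    by (simp add: gap_def)
qed

section \<open>Fixed points of the relaxed operator\<close>

lemma V_T_star_fixed_iff:
  fixes A B :: "'a::real_inner set"
  assumes "\<beta> < 1"
  shows "V B (T_star A B) \<beta> u = u \<longleftrightarrow>
    u = proj B u - (\<beta> / (1 - \<beta>)) *\<^sub>R (proj B u - proj A (refl_proj B u))"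
proof -
  define d where "d = proj B u - proj A (refl_proj B u)"
  have "T_star A B u = (1/2) *\<^sub>R (2 *\<^sub>R (u - d))"
    by (simp add: T_star_def refl_proj_def d_def scaleR_2 algebra_simps)
  then have T: "T_star A B u = u - d"
    by simp
  have "V B (T_star A B) \<beta> u - u = (1 - \<beta>) *\<^sub>R (proj B u - u) - \<beta> *\<^sub>R d"
    by (simp add: V_def T algebra_simps)
  also have "\<dots> = (1 - \<beta>) *\<^sub>R (proj B u - (\<beta> / (1 - \<beta>)) *\<^sub>R d - u)"
    using assms by (simp add: scaleR_diff_right)
  finally have "V B (T_star A B) \<beta> u - u
      = (1 - \<beta>) *\<^sub>R (proj B u - (\<beta> / (1 - \<beta>)) *\<^sub>R d - u)" .
  then show ?thesis
    using assms unfolding d_def[symmetric]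
    by (metis diff_gt_0_iff_gt eq_iff_diff_eq_0 less_irrefl scaleR_eq_0_iff)
qed

theorem theorem2p2:
  fixes A B :: "'a::{real_inner, complete_space} set" and \<beta> :: real
  assumes "A \<noteq> {}" and "closed A" and "convex A"
    and "B \<noteq> {}" and "closed B" and "convex B"
    and "0 < \<beta>" and "\<beta> < 1"
  shows "Fix (V B (T_star A B) \<beta>)
           = (\<lambda>f. f - (\<beta> / (1 - \<beta>)) *\<^sub>R gap A B) ` nearest_in_snd A B
       \<and> (\<forall>u \<in> Fix (V B (T_star A B) \<beta>).
            u = proj B u - (\<beta> / (1 - \<beta>)) *\<^sub>R gap A B
          \<and> proj B u - proj A (refl_proj B u) = gap A B
          \<and> proj B u \<in> nearest_in_snd A B
          \<and> proj A (proj B u) \<in> nearest_in_fst A B)"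
proof -
  define \<gamma> where "\<gamma> = \<beta> / (1 - \<beta>)"
  have \<gamma>: "0 < \<gamma>" "0 < 1 + \<gamma>"
    using assms(7,8) by (simp_all add: \<gamma>_def add_pos_pos)
  note A = assms(1-3) and B = assms(4-6)
  note gap_iff = gap_eq_iff_proj[OF A(2,3) B(2,3)]
  have props: "u = proj B u - \<gamma> *\<^sub>R gap A B \<and> proj B u - proj A (refl_proj B u) = gap A B
      \<and> proj B u \<in> nearest_in_snd A B \<and> proj A (proj B u) \<in> nearest_in_fst A B"
    if "u \<in> Fix (V B (T_star A B) \<beta>)" for u
  proof -
    define b where "b = proj B u"
    define a where "a = proj A (refl_proj B u)"
    have mem: "a \<in> A" "b \<in> B"
      using proj_nearest(1)[OF A] proj_nearest(1)[OF B] by (auto simp: a_def b_def)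
    have u: "u = b - \<gamma> *\<^sub>R (b - a)"
      using that V_T_star_fixed_iff[OF assms(8), of B A u, THEN iffD1]
      unfolding Fix_def a_def b_def \<gamma>_def by blast
    then have "refl_proj B u = a + (1 + \<gamma>) *\<^sub>R (b - a)"
      unfolding refl_proj_def b_def[symmetric] by (simp add: scaleR_2 algebra_simps)
    then have gap: "gap A B = b - a"
      using gap_iff[OF mem \<gamma>] u by (metis a_def b_def)
    then have "proj A b = a"
      using gap_iff[OF mem \<gamma>(1) zero_less_one] by simp
    then show ?thesis
      using gap_realizers_nearest[OF A(3) B(3) mem gap[symmetric]] gap u
      unfolding a_def[symmetric] b_def[symmetric] by simp
  qed
  have "f - \<gamma> *\<^sub>R gap A B \<in> Fix (V B (T_star A B) \<beta>)" if f: "f \<in> nearest_in_snd A B" for f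
  proof -
    define a where "a = proj A f"
    define u where "u = f - \<gamma> *\<^sub>R gap A B"
    have gap: "gap A B = f - a"
      using nearest_in_snd_diff_proj[OF A B(3) f] by (simp add: a_def)
    have mem: "a \<in> A" "f \<in> B"
      using proj_nearest(1)[OF A] f by (auto simp: a_def nearest_in_snd_def)
    have pB: "proj B u = f" and pA: "proj A (a + (1 + \<gamma>) *\<^sub>R (f - a)) = a"
      using gap_iff[OF mem \<gamma>] gap by (auto simp: u_def)
    have "refl_proj B u = a + (1 + \<gamma>) *\<^sub>R (f - a)"
      unfolding refl_proj_def pB by (simp add: u_def gap scaleR_2 algebra_simps)
    then have "V B (T_star A B) \<beta> u = u"
      using pA pB gap by (intro V_T_star_fixed_iff[OF assms(8), THEN iffD2]) (simp add: u_def \<gamma>_def)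
    then show ?thesis
      by (simp add: Fix_def u_def)
  qed
  then have "Fix (V B (T_star A B) \<beta>) = (\<lambda>f. f - \<gamma> *\<^sub>R gap A B) ` nearest_in_snd A B"
    using props by blast
  then show ?thesis
    using props by (simp add: \<gamma>_def)
qed

end
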